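(* Assume the nonresonance condition: the only function $u^h:N^+\to\mathbb{C}$ with $L^h u^h=0$ on $M^+$ and $u^h|_\gamma=0$ is $u^h=0$. Let $f^{h,+}$ and $f^{h,-}$ be finitely supported source vectors on $\mathbb{Z}^d$ with $\operatorname{supp}f^{h,\pm}\subseteq M^\pm$, let $u^{h,\pm}=G^h\ast f^{h,\pm}$ and $u^h=u^{h,+}+u^{h,-}$. Given the trace $\xi_\gamma=u^h|_\gamma$ of the total field, pick any compactly (finitely) supported $V^h:\mathbb{Z}^d\to\mathbb{C}$ with $V^h|_\gamma=\xi_\gamma$ and define $$g^h=-(L^hV^h)\cdot\mathbf 1_{M^-}.$$ Then the outgoing solution $\widetilde u^h=G^h\ast(f^{h,+}+f^{h,-}+g^h)$ of $L^h\widetilde u^h=f^{h,+}+f^{h,-}+g^h$ satisfies $$\widetilde u^h|_{N^+}=u^{h,+}|_{N^+}.$$ Furthermore, $g^h$ is independent of $V^h$ up to an additive term annihilated on $N^+$ by LGF convolution: if $g^h_1,g^h_2$ are obtained from two compactly supported extensions of $\xi_\gamma$, then $(G^h\ast(g^h_1-g^h_2))|_{N^+}=0$.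
   Context: Lattice and operator. Let $d\in\{2,3\}$, $h>0$, wavenumber $k>0$. Functions on the lattice $\Lambda_h=h\mathbb{Z}^d$ are indexed by $\mathbb{Z}^d$ (node $h\bm m\leftrightarrow\bm m$). The discrete Helmholtz operator is $$(L^hv)_{\bm m}=-\frac1{h^2}\sum_{\bm e\in\mathbb{Z}^d,\,|\bm e|_1=1}(v_{\bm m+\bm e}-v_{\bm m})-k^2v_{\bm m}.$$ Geometry. $\Omega_{\rm in}\subset\mathbb{R}^d$ is a bounded Lipschitz domain, $M^+=\{\bm m\in\mathbb{Z}^d: h\bm m\in\Omega_{\rm in}\}$, $M^-=\{\bm m\in\mathbb{Z}^d: h\bm m\notin\overline{\Omega_{\rm in}}\}$, and no lattice node lies on $\partial\Omega_{\rm in}$, so $\mathbb{Z}^d=M^+\sqcup M^-$. $N^\pm$ is the set of all nodes of the stencils of $L^h$ centred in $M^\pm$: $N^\pm=M^\pm\cup\{\bm m+\bm e:\bm m\in M^\pm,|\bm e|_1=1\}$. The boundary strip is $\gamma=N^+\cap N^-$. $\mathbf{1}_A$ is the indicator of $A$. Lattice Green's function (LGF). $$G^h_{\bm m}=\frac1{(2\pi)^d}\int_{[-\pi,\pi]^d}\frac{e^{i\bm m\cdot\bm\theta}}{\sigma(\bm\theta)-k^2h^2+i0^+}\,d\bm\theta,\qquad \sigma(\bm\theta)=\sum_{j=1}^d2(1-\cos\theta_j),$$ where $i0^+$ means the limit $\varepsilon\to0^+$ with $i\varepsilon$ in place of $i0^+$; $(h,k)$ are assumed such that the limit exists. Then $L^hG^h=h^{-2}\delta_{\bm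 0}$. For finitely supported $f$, $(G^h\ast f)_{\bm m}=h^2\sum_{\bm n}G^h_{\bm m-\bm n}f_{\bm n}$, so $L^h(G^h\ast f)=f$; $G^h\ast f$ is called the outgoing solution generated by $f$. *)

theory Defs
  imports "HOL-Analysis.Analysis"
begin

text \<open>
  The dimension \<open>d\<close> is \<open>CARD('n)\<close>. Lattice indices live in \<open>int ^ 'n\<close>, and index \<open>m\<close> stands for
  the node \<open>h m\<close> of the lattice \<open>h \<int>\<^sup>d\<close>.
\<close>

definition node :: "real \<Rightarrow> int ^ 'n \<Rightarrow> real ^ 'n" where
  "node h m = (\<chi> j. h * real_of_int (m $ j))"

definition unit_steps :: "(int ^ 'n::finite) set" where
  "unit_steps = {e. (\<Sum>j\<in>UNIV. \<bar>e $ j\<bar>) = 1}"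

lemma finite_unit_steps: "finite (unit_steps :: (int ^ 'n::finite) set)"
proof (rule finite_subset)
  show "unit_steps \<subseteq> vec_lambda ` (UNIV \<rightarrow>\<^sub>E {-1..1::int} :: ('n \<Rightarrow> int) set)"
  proof
    fix e :: "int ^ 'n"
    assume "e \<in> unit_steps"
    then have s: "(\<Sum>j\<in>UNIV. \<bar>e $ j\<bar>) = 1" by (simp add: unit_steps_def)
    have "\<bar>e $ j\<bar> \<le> 1" for j
      using member_le_sum[of j UNIV "\<lambda>j. \<bar>e $ j\<bar>"] s by simp
    then have "vec_nth e \<in> UNIV \<rightarrow>\<^sub>E {-1..1}" by (auto simp: abs_le_iff minus_le_iff)
    then show "e \<in> vec_lambda ` (UNIV \<rightarrow>\<^sub>E {-1..1})"
      by (metis image_eqI vec_nth_inverse)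
  qed
qed (intro finite_imageI finite_PiE, auto)

definition helmholtz :: "real \<Rightarrow> real \<Rightarrow> (int ^ 'n::finite \<Rightarrow> complex) \<Rightarrow> int ^ 'n \<Rightarrow> complex" where
  "helmholtz h k v m =
     - (1 / (complex_of_real h)\<^sup>2) * (\<Sum>e\<in>unit_steps. v (m + e) - v m)
     - (complex_of_real k)\<^sup>2 * v m"

text \<open>
  Near each boundary point, the domain is the strict epigraph, in some direction \<open>\<nu>\<close>, of a Lipschitz
  function \<open>\<phi>\<close> on the hyperplane orthogonal to \<open>\<nu>\<close>. Since \<open>\<phi>\<close> can be extended from a neighbourhood
  to the whole hyperplane with the same Lipschitz constant, taking \<open>\<phi>\<close> globally defined is no
  restriction.
\<close>

definition bounded_lipschitz_domain :: "(real ^ 'n::finite) set \<Rightarrow> bool" where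
  "bounded_lipschitz_domain \<Omega> \<longleftrightarrow>
     open \<Omega> \<and> connected \<Omega> \<and> \<Omega> \<noteq> {} \<and> bounded \<Omega> \<and>
     (\<forall>x\<in>frontier \<Omega>. \<exists>r>0. \<exists>\<nu>. \<exists>\<phi> :: real ^ 'n \<Rightarrow> real. \<exists>L.
        norm \<nu> = 1 \<and> L-lipschitz_on {z. z \<bullet> \<nu> = 0} \<phi> \<and>
        \<Omega> \<inter> ball x r = {y \<in> ball x r. \<phi> (y - (y \<bullet> \<nu>) *\<^sub>R \<nu>) < y \<bullet> \<nu>})"

definition M_plus :: "real \<Rightarrow> (real ^ 'n) set \<Rightarrow> (int ^ 'n) set" where
  "M_plus h \<Omega> = {m. node h m \<in> \<Omega>}"

definition M_minus :: "real \<Rightarrow> (real ^ 'n::finite) set \<Rightarrow> (int ^ 'n) set" where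
  "M_minus h \<Omega> = {m. node h m \<notin> closure \<Omega>}"

definition stencil_nodes :: "(int ^ 'n::finite) set \<Rightarrow> (int ^ 'n) set" where
  "stencil_nodes M = M \<union> {m + e | m e. m \<in> M \<and> e \<in> unit_steps}"

definition N_plus :: "real \<Rightarrow> (real ^ 'n::finite) set \<Rightarrow> (int ^ 'n) set" where
  "N_plus h \<Omega> = stencil_nodes (M_plus h \<Omega>)"

definition N_minus :: "real \<Rightarrow> (real ^ 'n::finite) set \<Rightarrow> (int ^ 'n) set" where
  "N_minus h \<Omega> = stencil_nodes (M_minus h \<Omega>)"

definition boundary_strip :: "real \<Rightarrow> (real ^ 'n::finite) set \<Rightarrow> (int ^ 'n) set" where
  "boundary_strip h \<Omega> = N_plus h \<Omega> \<inter> N_minus h \<Omega>"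

text \<open>
  \<open>helmholtz h k u m\<close> for \<open>m\<close> in \<open>M_plus\<close> only involves the values of \<open>u\<close> on \<open>N_plus\<close>, so a function
  on \<open>N_plus\<close> may be represented by any total function extending it.
\<close>

definition nonresonant :: "real \<Rightarrow> real \<Rightarrow> (real ^ 'n::finite) set \<Rightarrow> bool" where
  "nonresonant h k \<Omega> \<longleftrightarrow>
     (\<forall>u :: int ^ 'n \<Rightarrow> complex.
        (\<forall>m\<in>M_plus h \<Omega>. helmholtz h k u m = 0) \<and> (\<forall>m\<in>boundary_strip h \<Omega>. u m = 0)
        \<longrightarrow> (\<forall>m\<in>N_plus h \<Omega>. u m = 0))"

definition symbol :: "real ^ 'n::finite \<Rightarrow> real" where
  "symbol \<theta> = (\<Sum>j\<in>UNIV. 2 * (1 - cos (\<theta> $ j)))"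

definition lgf_reg :: "real \<Rightarrow> real \<Rightarrow> real \<Rightarrow> int ^ 'n::finite \<Rightarrow> complex" where
  "lgf_reg h k \<epsilon> m =
     1 / (2 * complex_of_real pi) ^ CARD('n) *
     integral (cbox (\<chi> j. - pi) (\<chi> j. pi) :: (real ^ 'n) set)
       (\<lambda>\<theta>. exp (\<i> * complex_of_real (\<Sum>j\<in>UNIV. real_of_int (m $ j) * \<theta> $ j)) /
            (complex_of_real (symbol \<theta> - k\<^sup>2 * h\<^sup>2) + \<i> * complex_of_real \<epsilon>))"

definition lgf :: "real \<Rightarrow> real \<Rightarrow> int ^ 'n::finite \<Rightarrow> complex" where
  "lgf h k m = Lim (at_right 0) (\<lambda>\<epsilon>. lgf_reg h k \<epsilon> m)"

text \<open>The type argument fixes the dimension, which \<open>h\<close> and \<open>k\<close> alone do not determine.\<close>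

definition lgf_exists :: "'n::finite itself \<Rightarrow> real \<Rightarrow> real \<Rightarrow> bool" where
  "lgf_exists _ h k \<longleftrightarrow>
     (\<forall>m :: int ^ 'n. \<exists>l. ((\<lambda>\<epsilon>. lgf_reg h k \<epsilon> m) \<longlongrightarrow> l) (at_right 0))"

definition support :: "('a \<Rightarrow> complex) \<Rightarrow> 'a set" where
  "support f = {x. f x \<noteq> 0}"

text \<open>The lattice convolution \<open>G\<^sup>h * f\<close>; meaningful only if \<open>support f\<close> is finite.\<close>

definition outgoing :: "real \<Rightarrow> real \<Rightarrow> (int ^ 'n::finite \<Rightarrow> complex) \<Rightarrow> int ^ 'n \<Rightarrow> complex" where
  "outgoing h k f m = (complex_of_real h)\<^sup>2 * (\<Sum>n\<in>support f. lgf h k (m - n) * f n)"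

definition trace_extension ::
    "real \<Rightarrow> (real ^ 'n::finite) set \<Rightarrow> (int ^ 'n \<Rightarrow> complex) \<Rightarrow> (int ^ 'n \<Rightarrow> complex) \<Rightarrow> bool" where
  "trace_extension h \<Omega> u V \<longleftrightarrow>
     finite (support V) \<and> (\<forall>m\<in>boundary_strip h \<Omega>. V m = u m)"

definition aux_source ::
    "real \<Rightarrow> real \<Rightarrow> (real ^ 'n::finite) set \<Rightarrow> (int ^ 'n \<Rightarrow> complex) \<Rightarrow> int ^ 'n \<Rightarrow> complex" where
  "aux_source h k \<Omega> V m = - helmholtz h k V m * indicator (M_minus h \<Omega>) m"

end

theory Submission
  imports Defs
begin

text \<open>
  Replace an extension \<open>V\<close> of the trace by the total field \<open>u\<close> on \<open>N_plus\<close> and keep it elsewhere. Since the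
  two agree on the strip, the result \<open>W\<close> is still equal to \<open>V\<close> on \<open>N_minus\<close>, and it is finitely
  supported, so \<open>W = G * (L W)\<close>. The source \<open>L W\<close> is \<open>L u = fp\<close> on \<open>M_plus\<close> and \<open>L V = - g\<close> on
  \<open>M_minus\<close>, whence \<open>W = up - G * g\<close> everywhere. On \<open>N_plus\<close> this reads \<open>G * g = up - u = - um\<close>,
  from which both claims follow. The identity \<open>L G = \<delta> / h\<^sup>2\<close> follows from its regularised version,
  whose error term \<open>\<epsilon> G\<^sub>\<epsilon>\<close> vanishes because \<open>G\<^sub>\<epsilon>\<close> converges.
\<close>

section \<open>Stencil sums\<close>

text \<open>Nonnegative integers summing to 1 are all 0 except for a single 1, so a step is a signed
  coordinate vector. The image form lets stencil sums be reindexed by direction and sign.\<close>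

lemma unit_steps_eq:
  "(unit_steps :: (int ^ 'n::finite) set) = (\<lambda>(j, s). axis j s) ` (UNIV \<times> {1, -1})"
proof (intro equalityI subsetI)
  fix e :: "int ^ 'n" assume "e \<in> unit_steps"
  then have s: "(\<Sum>j\<in>UNIV. \<bar>e $ j\<bar>) = 1" by (simp add: unit_steps_def)
  obtain i where i: "e $ i \<noteq> 0"
  proof (rule ccontr)
    assume "\<not> thesis"
    then have "\<forall>i. e $ i = 0" using that by blast
    then show False using s by simp
  qed
  have "\<bar>e $ i\<bar> + (\<Sum>j\<in>UNIV - {i}. \<bar>e $ j\<bar>) = 1"
    using s by (simp add: sum.remove[of UNIV i])
  moreover have "(\<Sum>j\<in>UNIV - {i}. \<bar>e $ j\<bar>) \<ge> 0" by (simp add: sum_nonneg)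
  ultimately have a: "\<bar>e $ i\<bar> = 1" and "(\<Sum>j\<in>UNIV - {i}. \<bar>e $ j\<bar>) = 0"
    using i by linarith+
  then have z: "e $ j = 0" if "j \<noteq> i" for j
    using that by (simp add: sum_nonneg_eq_0_iff)
  have "e = axis i (e $ i)"
    using z by (auto simp: vec_eq_iff axis_def)
  moreover have "e $ i \<in> {1, -1}" using a by (auto simp: abs_if split: if_splits)
  ultimately show "e \<in> (\<lambda>(j, s). axis j s) ` (UNIV \<times> {1, -1})"
    by (metis (no_types, lifting) SigmaI UNIV_I case_prod_conv image_eqI)
next
  fix e :: "int ^ 'n" assume "e \<in> (\<lambda>(j, s). axis j s) ` (UNIV \<times> {1, -1})"
  then obtain i s where e: "e = axis i s" "s \<in> {1, -1}" by auto
  have "(\<Sum>j\<in>UNIV. \<bar>e $ j\<bar>) = (\<Sum>j\<in>UNIV. if j = i then \<bar>s\<bar> else 0)"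
    using e by (intro sum.cong) (auto simp: axis_def)
  then show "e \<in> unit_steps" using e by (auto simp: unit_steps_def)
qed

lemma sum_unit_steps:
  fixes f :: "int ^ 'n::finite \<Rightarrow> 'b::comm_monoid_add"
  shows "(\<Sum>e\<in>unit_steps. f e) = (\<Sum>j\<in>UNIV. f (axis j 1) + f (axis j (-1)))"
proof -
  have "inj_on (\<lambda>(j, s). axis j s :: int ^ 'n) (UNIV \<times> {1, -1})"
    by (auto simp: inj_on_def axis_eq_axis)
  then have "(\<Sum>e\<in>unit_steps. f e) = (\<Sum>(j, s)\<in>UNIV \<times> {1, -1}. f (axis j s))"
    by (simp add: unit_steps_eq sum.reindex case_prod_unfold)
  also have "\<dots> = (\<Sum>j\<in>UNIV. \<Sum>s\<in>{1, -1}. f (axis j s))"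
    by (rule sum.cartesian_product[symmetric])
  finally show ?thesis by simp
qed

lemma uminus_unit_steps: "e \<in> unit_steps \<Longrightarrow> - e \<in> unit_steps"
  by (simp add: unit_steps_def)

lemma sum_unit_steps_uminus: "(\<Sum>e\<in>unit_steps. f (- e)) = (\<Sum>e\<in>unit_steps. f e)"
  by (rule sum.reindex_bij_witness[of _ uminus uminus]) (auto simp: uminus_unit_steps)

lemma helmholtz_cong:
  assumes "v m = w m" "\<And>e. e \<in> unit_steps \<Longrightarrow> v (m + e) = w (m + e)"
  shows "helmholtz h k v m = helmholtz h k w m"
  using assms by (simp add: helmholtz_def cong: sum.cong)

section \<open>Linearity and symmetries of the discrete operator\<close>

lemma helmholtz_add:
  "helmholtz h k (\<lambda>n. v n + w n) m = helmholtz h k v m + helmholtz h k w m"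
  by (simp add: helmholtz_def algebra_simps sum.distrib sum_subtractf)

lemma helmholtz_cmult:
  "helmholtz h k (\<lambda>n. c * v n) m = c * helmholtz h k v m"
proof -
  have "(\<Sum>e\<in>unit_steps. c * v (m + e) - c * v m) = c * (\<Sum>e\<in>unit_steps. v (m + e) - v m)"
    by (simp add: sum_distrib_left right_diff_distrib)
  then show ?thesis by (simp add: helmholtz_def algebra_simps)
qed

lemma helmholtz_sum:
  "helmholtz h k (\<lambda>n. \<Sum>a\<in>A. v a n) m = (\<Sum>a\<in>A. helmholtz h k (v a) m)"
\<comment> \<open>For infinite \<open>A\<close> both sums take the default value 0, so no finiteness
  assumption is required.\<close>
proof (induction A rule: infinite_finite_induct)
  case (insert a A)
  then show ?case by (simp add: helmholtz_add)
qed (simp_all add: helmholtz_def)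

lemma helmholtz_shift:
  "helmholtz h k (\<lambda>n. v (n + a)) m = helmholtz h k v (m + a)"
  by (simp add: helmholtz_def ac_simps)

text \<open>The stencil is invariant under \<open>e\<close> to \<open>- e\<close>. This serves the
  kernel of the convolution as a function of the source node.\<close>

lemma helmholtz_reflect:
  "helmholtz h k (\<lambda>n. v (a - n)) m = helmholtz h k v (a - m)"
proof -
  have "(\<Sum>e\<in>unit_steps. v (a - (m + e)) - v (a - m))
      = (\<Sum>e\<in>unit_steps. v (a - m + e) - v (a - m))"
    using sum_unit_steps_uminus[of "\<lambda>e. v (a - m + e) - v (a - m)"] by (simp add: algebra_simps)
  then show ?thesis by (simp add: helmholtz_def)
qed

section \<open>Finite supports and summation by parts\<close>

lemma finite_support_helmholtz:
  fixes V :: "int ^ 'n::finite \<Rightarrow> complex"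
  assumes "finite (support V)"
  shows "finite (support (helmholtz h k V))"
proof (rule finite_subset)
  show "support (helmholtz h k V) \<subseteq> support V \<union> (\<lambda>(a, e). a - e) ` (support V \<times> unit_steps)"
  proof
    fix m assume m: "m \<in> support (helmholtz h k V)"
    show "m \<in> support V \<union> (\<lambda>(a, e). a - e) ` (support V \<times> unit_steps)"
    proof (rule ccontr)
      assume c: "\<not> ?thesis"
      have "V (m + e) = 0" if "e \<in> unit_steps" for e
      proof (rule ccontr)
        assume "V (m + e) \<noteq> 0"
        then have "(m + e, e) \<in> support V \<times> unit_steps" using that by (simp add: support_def)
        from imageI[OF this, of "\<lambda>(a, e). a - e"] show False using c by simp
      qed
      moreover have "V m = 0" using c by (simp add: support_def)
      ultimately have "helmholtz h k V m = 0" by (simp add: helmholtz_def)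
      then show False using m by (simp add: support_def)
    qed
  qed
qed (use assms finite_unit_steps in auto)

text \<open>Summation by parts without boundary terms: the operator is symmetric for the bilinear
  pairing. Only \<open>V\<close> has finite support, so that \<open>w\<close> can be a translate of
  the reflected Green's function.\<close>

lemma sum_helmholtz_symmetric:
  fixes V w :: "int ^ 'n::finite \<Rightarrow> complex"
  assumes V: "finite (support V)"
  shows "(\<Sum>n\<in>support (helmholtz h k V). w n * helmholtz h k V n)
       = (\<Sum>n\<in>support V. helmholtz h k w n * V n)"
proof -
  \<comment> \<open>One finite set carries every sum below: it contains all nodes whose stencil
    meets the support of \<open>V\<close>.\<close>
  define S where "S = support V \<union> (\<lambda>(a, e). a - e) ` (support V \<times> unit_steps)
    \<union> support (helmholtz h k V)"
  have fin: "finite S"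
    unfolding S_def using V finite_unit_steps finite_support_helmholtz[OF V] by auto
  have shift: "(\<Sum>n\<in>S. w n * V (n + e)) = (\<Sum>n\<in>support V. w (n - e) * V n)"
    if e: "e \<in> unit_steps" for e
  proof -
    have "(\<Sum>n\<in>S. w n * V (n + e)) = (\<Sum>n\<in>(\<lambda>a. a - e) ` support V. w n * V (n + e))"
    proof (rule sum.mono_neutral_right[OF fin])
      show "(\<lambda>a. a - e) ` support V \<subseteq> S" using e by (force simp: S_def)
      show "\<forall>n\<in>S - (\<lambda>a. a - e) ` support V. w n * V (n + e) = 0"
      proof
        fix n assume n: "n \<in> S - (\<lambda>a. a - e) ` support V"
        have "n + e \<notin> support V" using n image_eqI[of n "\<lambda>a. a - e" "n + e"] by auto
        then show "w n * V (n + e) = 0" by (simp add: support_def)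
      qed
    qed
    then show ?thesis by (simp add: sum.reindex inj_on_def)
  qed
  have diag: "(\<Sum>n\<in>S. w n * V n) = (\<Sum>n\<in>support V. w n * V n)"
    by (rule sum.mono_neutral_right[OF fin]) (auto simp: S_def support_def)
  let ?d = "of_nat (card (unit_steps :: (int ^ 'n) set)) :: complex"
  define c where "c = 1 / (complex_of_real h)\<^sup>2"
  \<comment> \<open>Only the neighbour sum needs rearranging; the diagonal part, in which
    \<open>?d\<close> is the number of neighbours, is trivially symmetric.\<close>
  have hh: "helmholtz h k v n = - c * (\<Sum>e\<in>unit_steps. v (n + e)) + (c * ?d - (complex_of_real k)\<^sup>2) * v n"
    for v :: "int ^ 'n \<Rightarrow> complex" and n
    by (simp add: helmholtz_def c_def sum_subtractf algebra_simps)
  have "(\<Sum>n\<in>support (helmholtz h k V). w n * helmholtz h k V n) = (\<Sum>n\<in>S. w n * helmholtz h k V n)"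
    by (rule sum.mono_neutral_left[OF fin]) (auto simp: S_def support_def)
  also have "\<dots> = - c * (\<Sum>n\<in>S. \<Sum>e\<in>unit_steps. w n * V (n + e))
      + (c * ?d - (complex_of_real k)\<^sup>2) * (\<Sum>n\<in>S. w n * V n)"
    unfolding hh by (simp add: sum.distrib sum_distrib_left algebra_simps sum_subtractf)
  also have "(\<Sum>n\<in>S. \<Sum>e\<in>unit_steps. w n * V (n + e)) = (\<Sum>e\<in>unit_steps. \<Sum>n\<in>support V. w (n - e) * V n)"
    by (subst sum.swap) (simp add: shift)
  also have "\<dots> = (\<Sum>e\<in>unit_steps. \<Sum>n\<in>support V. w (n + e) * V n)"
    using sum_unit_steps_uminus[of "\<lambda>e. \<Sum>n\<in>support V. w (n + e) * V n"] by simp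
  also have "\<dots> = (\<Sum>n\<in>support V. (\<Sum>e\<in>unit_steps. w (n + e)) * V n)"
    by (subst sum.swap) (simp add: sum_distrib_right)
  also have "- c * \<dots> + (c * ?d - (complex_of_real k)\<^sup>2) * (\<Sum>n\<in>S. w n * V n)
      = (\<Sum>n\<in>support V. helmholtz h k w n * V n)"
    unfolding hh diag
    by (simp add: sum.distrib sum_distrib_left algebra_simps sum_subtractf)
  finally show ?thesis .
qed

section \<open>The lattice Green's function\<close>

text \<open>Fubini for a product of one-variable functions, obtained by passing to the Lebesgue
  integral and its product measure, then back.\<close>

lemma integral_cbox_prod:
  fixes f :: "'n::finite \<Rightarrow> real \<Rightarrow> complex"
  assumes cont: "\<And>j. continuous_on UNIV (f j)"
  shows "integral (cbox (\<chi> j. a) (\<chi> j. b) :: (real ^ 'n) set) (\<lambda>x. \<Prod>j\<in>UNIV. f j (x $ j))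
       = (\<Prod>j\<in>UNIV. integral {a..b} (f j))"
proof -
  interpret product_sigma_finite "\<lambda>_ :: real ^ 'n. lborel :: real measure"
    by standard
  let ?C = "cbox (\<chi> j. a) (\<chi> j. b) :: (real ^ 'n) set"
  \<comment> \<open>The cutoff to the interval is put into each factor, so the integral over the
    whole space factorises; \<open>axis_index\<close> recovers the coordinate from its basis
    vector.\<close>
  define F where "F = (\<lambda>(v :: real ^ 'n) x. indicator {a..b} x *\<^sub>R f (axis_index v) x)"
  have meas [measurable]: "f j \<in> borel_measurable borel" for j
    using cont by (rule borel_measurable_continuous_onI)
  have int1: "set_integrable lborel {a..b} (f j)" for j
    by (rule borel_integrable_atLeastAtMost') (use cont continuous_on_subset in blast)
  have F: "integrable lborel (F v)" for v
    using int1 unfolding F_def set_integrable_def .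
  have Basis: "(Basis :: (real ^ 'n) set) = (\<lambda>j. axis j 1) ` UNIV"
    by (auto simp: Basis_vec_def)
  have inj: "inj (\<lambda>j :: 'n. axis j (1 :: real))"
    by (auto simp: inj_on_def axis_eq_axis)
  have prodF: "(\<Prod>v\<in>Basis. F v (x \<bullet> v)) = indicator ?C x *\<^sub>R (\<Prod>j\<in>UNIV. f j (x $ j))"
    for x :: "real ^ 'n"
  proof -
    have "(\<Prod>v\<in>Basis. F v (x \<bullet> v)) = (\<Prod>j\<in>UNIV. indicator {a..b} (x $ j) *\<^sub>R f j (x $ j))"
      by (simp add: Basis prod.reindex[OF inj] F_def inner_axis axis_index_axis)
    also have "\<dots> = indicator ?C x *\<^sub>R (\<Prod>j\<in>UNIV. f j (x $ j))"
    proof (cases "x \<in> ?C")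
      case True
      then show ?thesis by (simp add: mem_box_cart)
    next
      case False
      then obtain j where "x $ j \<notin> {a..b}" by (auto simp: mem_box_cart)
      then have "(\<Prod>j\<in>UNIV. indicator {a..b} (x $ j) *\<^sub>R f j (x $ j)) = 0"
        by (intro prod_zero bexI[of _ j]) auto
      then show ?thesis using False by simp
    qed
    finally show ?thesis .
  qed
  have contP: "continuous_on UNIV (\<lambda>x :: real ^ 'n. \<Prod>j\<in>UNIV. f j (x $ j))"
    by (intro continuous_on_prod continuous_on_compose2[OF cont] continuous_intros) auto
  have "integral ?C (\<lambda>x. \<Prod>j\<in>UNIV. f j (x $ j)) = (LINT x:?C|lborel. (\<Prod>j\<in>UNIV. f j (x $ j)))"
    by (rule set_borel_integral_eq_integral(2)[symmetric])
       (auto simp: set_integrable_def intro!: borel_integrable_compact continuous_on_subset[OF contP])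
  also have "\<dots> = (LINT x|lborel. (\<Prod>v\<in>Basis. F v (x \<bullet> v)))"
    by (simp add: set_lebesgue_integral_def prodF)
  \<comment> \<open>Lebesgue measure is the image of the product measure indexed by
    \<open>Basis\<close> under the map from coordinates to vectors.\<close>
  also have "\<dots> = (LINT y|(\<Pi>\<^sub>M v\<in>Basis. lborel). (\<Prod>v\<in>Basis. F v ((\<Sum>b\<in>Basis. y b *\<^sub>R b) \<bullet> v)))"
    by (subst lborel_eq, rule integral_distr) (auto simp: F_def)
  also have "\<dots> = (LINT y|(\<Pi>\<^sub>M v\<in>Basis. lborel). (\<Prod>v\<in>Basis. F v (y v)))"
    by (intro Bochner_Integration.integral_cong prod.cong) auto
  also have "\<dots> = (\<Prod>v\<in>(Basis :: (real ^ 'n) set). integral\<^sup>L lborel (F v))"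
    by (rule product_integral_prod) (auto simp: F)
  also have "\<dots> = (\<Prod>j\<in>UNIV. LINT x:{a..b}|lborel. f j x)"
    by (simp add: Basis prod.reindex[OF inj] F_def axis_index_axis set_lebesgue_integral_def)
  also have "\<dots> = (\<Prod>j\<in>UNIV. integral {a..b} (f j))"
    by (simp add: set_borel_integral_eq_integral(2)[OF int1])
  finally show ?thesis .
qed

text \<open>For nonzero frequency the antiderivative has period \<open>2 * pi\<close>, so its
  endpoint values cancel.\<close>

lemma integral_character_1d:
  "integral {-pi..pi} (\<lambda>t. exp (\<i> * complex_of_real (real_of_int k * t)))
     = (if k = 0 then 2 * complex_of_real pi else 0)"
proof (cases "k = 0")
  case True
  then show ?thesis by (simp add: scaleR_conv_of_real)
next
  case False
  let ?F = "\<lambda>t :: real. exp (\<i> * complex_of_real (real_of_int k * t)) / (\<i> * of_int k)"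
  have "((\<lambda>t. exp (\<i> * complex_of_real (real_of_int k * t))) has_integral (?F pi - ?F (-pi))) {-pi..pi}"
  proof (rule fundamental_theorem_of_calculus)
    fix t :: real
    have "((\<lambda>z. exp (\<i> * of_int k * z) / (\<i> * of_int k)) has_field_derivative exp (\<i> * of_int k * of_real t))
        (at (complex_of_real t))"
      using False by (auto intro!: derivative_eq_intros)
    from has_vector_derivative_real_field[OF this]
    show "(?F has_vector_derivative exp (\<i> * complex_of_real (real_of_int k * t)))
        (at t within {-pi..pi})"
      by (simp add: mult.assoc has_vector_derivative_at_within)
  qed simp
  moreover have "exp (\<i> * complex_of_real (real_of_int k * pi)) = exp (\<i> * complex_of_real (real_of_int k * - pi))"
    \<comment> \<open>The two exponents differ by \<open>k\<close> full periods of the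
      exponential.\<close>
    unfolding exp_eq by (intro exI[of _ k]) (simp add: algebra_simps)
  ultimately show ?thesis using False by (simp add: integral_unique)
qed

definition character :: "int ^ 'n::finite \<Rightarrow> real ^ 'n \<Rightarrow> complex" where
  "character m \<theta> = exp (\<i> * complex_of_real (\<Sum>j\<in>UNIV. real_of_int (m $ j) * \<theta> $ j))"

abbreviation torus_cell :: "(real ^ 'n::finite) set" where
  "torus_cell \<equiv> cbox (\<chi> j. - pi) (\<chi> j. pi)"

text \<open>The exponential of the sum factorises over coordinates, and one nonzero frequency
  annihilates the product. This orthogonality produces the delta source.\<close>

lemma integral_character:
  fixes m :: "int ^ 'n::finite"
  shows "integral torus_cell (character m) = (if m = 0 then (2 * complex_of_real pi) ^ CARD('n) else 0)"
proof -
  have "integral torus_cell (character m)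
      = integral torus_cell (\<lambda>\<theta>. \<Prod>j\<in>UNIV. exp (\<i> * complex_of_real (real_of_int (m $ j) * \<theta> $ j)))"
    by (simp add: character_def[abs_def] exp_sum sum_distrib_left)
  also have "\<dots> = (\<Prod>j\<in>UNIV. integral {-pi..pi} (\<lambda>t. exp (\<i> * complex_of_real (real_of_int (m $ j) * t))))"
    by (rule integral_cbox_prod) (intro continuous_intros)
  also have "\<dots> = (\<Prod>j\<in>UNIV. if m $ j = 0 then 2 * complex_of_real pi else 0)"
    by (simp only: integral_character_1d)
  also have "\<dots> = (if m = 0 then (2 * complex_of_real pi) ^ CARD('n) else 0)"
  proof (cases "m = 0")
    case False
    then obtain j where "m $ j \<noteq> 0" by (auto simp: vec_eq_iff)
    then show ?thesis using False by (auto intro!: prod_zero)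
  qed simp
  finally show ?thesis .
qed

lemma character_add: "character (m + n) \<theta> = character m \<theta> * character n \<theta>"
  by (simp add: character_def algebra_simps sum.distrib flip: exp_add)

lemma character_axis: "character (axis j s) \<theta> = exp (\<i> * complex_of_real (real_of_int s * \<theta> $ j))"
proof -
  have "(\<Sum>i\<in>UNIV. real_of_int ((axis j s :: int ^ 'a) $ i) * \<theta> $ i)
      = (\<Sum>i\<in>UNIV. if i = j then real_of_int s * \<theta> $ i else 0)"
    by (intro sum.cong) (auto simp: axis_def)
  then show ?thesis by (simp add: character_def)
qed

text \<open>Characters are eigenfunctions: opposite steps along an axis combine through Euler's
  formula into the cosine term of \<open>symbol\<close>.\<close>

lemma helmholtz_character:
  fixes \<theta> :: "real ^ 'n::finite"
  assumes "h \<noteq> 0"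
  shows "helmholtz h k (\<lambda>m. character m \<theta>) m
       = 1 / (complex_of_real h)\<^sup>2 * complex_of_real (symbol \<theta> - k\<^sup>2 * h\<^sup>2) * character m \<theta>"
proof -
  have "exp (\<i> * complex_of_real t) + exp (- (\<i> * complex_of_real t)) - 2 = - complex_of_real (2 * (1 - cos t))" for t
    using exp_Euler[of "complex_of_real t"] exp_Euler[of "- complex_of_real t"]
    by (simp add: cos_of_real sin_of_real)
  then have "(\<Sum>e\<in>unit_steps. character e \<theta> - 1) = - complex_of_real (symbol \<theta>)"
    unfolding sum_unit_steps character_axis unfolding symbol_def of_real_sum sum_negf[symmetric]
    by (intro sum.cong) (auto simp: algebra_simps)
  moreover have "(\<Sum>e\<in>unit_steps. character (m + e) \<theta> - character m \<theta>)
      = character m \<theta> * (\<Sum>e\<in>unit_steps. character e \<theta> - 1)"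
    by (simp add: character_add sum_distrib_left right_diff_distrib)
  ultimately have "(\<Sum>e\<in>unit_steps. character (m + e) \<theta> - character m \<theta>)
      = - (character m \<theta> * complex_of_real (symbol \<theta>))"
    by simp
  then show ?thesis
    using assms by (simp add: helmholtz_def field_simps)
qed

section \<open>The regularised Green's function and its limit\<close>

definition lgf_integrand :: "real \<Rightarrow> real \<Rightarrow> real \<Rightarrow> int ^ 'n::finite \<Rightarrow> real ^ 'n \<Rightarrow> complex" where
  "lgf_integrand h k \<epsilon> m \<theta> =
     character m \<theta> / (complex_of_real (symbol \<theta> - k\<^sup>2 * h\<^sup>2) + \<i> * complex_of_real \<epsilon>)"

lemma lgf_reg_eq:
  "lgf_reg h k \<epsilon> (m :: int ^ 'n::finite)
     = 1 / (2 * complex_of_real pi) ^ CARD('n) * integral torus_cell (lgf_integrand h k \<epsilon> m)"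
  unfolding lgf_reg_def lgf_integrand_def[abs_def] character_def ..

lemma denominator_nonzero:
  "\<epsilon> \<noteq> 0 \<Longrightarrow> complex_of_real x + \<i> * complex_of_real \<epsilon> \<noteq> 0"
  by (simp add: complex_eq_iff)

text \<open>A nonzero \<epsilon> keeps the denominator away from zero, so the integrand is
  continuous on the compact cell.\<close>

lemma integrable_lgf_integrand:
  assumes "\<epsilon> \<noteq> 0"
  shows "lgf_integrand h k \<epsilon> m integrable_on torus_cell"
  unfolding lgf_integrand_def[abs_def] character_def symbol_def
  by (intro integrable_continuous continuous_intros) (use denominator_nonzero[OF assms] in blast)

lemma integrable_character: "character m integrable_on torus_cell"
  unfolding character_def[abs_def] by (intro integrable_continuous continuous_intros)

lemma helmholtz_integral:
  fixes F :: "int ^ 'n::finite \<Rightarrow> real ^ 'n \<Rightarrow> complex"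
  assumes "\<And>n. F n integrable_on S"
  shows "helmholtz h k (\<lambda>n. integral S (F n)) m = integral S (\<lambda>\<theta>. helmholtz h k (\<lambda>n. F n \<theta>) m)"
proof (rule integral_unique[symmetric])
  show "((\<lambda>\<theta>. helmholtz h k (\<lambda>n. F n \<theta>) m) has_integral helmholtz h k (\<lambda>n. integral S (F n)) m) S"
    unfolding helmholtz_def
    by (intro has_integral_diff has_integral_mult_right has_integral_sum finite_unit_steps
        integrable_integral assms)
qed

lemma helmholtz_lgf_integrand:
  assumes "h \<noteq> 0" "\<epsilon> \<noteq> 0"
  shows "helmholtz h k (\<lambda>n. lgf_integrand h k \<epsilon> n \<theta>) m
       = 1 / (complex_of_real h)\<^sup>2 * (character m \<theta> - \<i> * complex_of_real \<epsilon> * lgf_integrand h k \<epsilon> m \<theta>)"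
proof -
  define D where "D = complex_of_real (symbol \<theta> - k\<^sup>2 * h\<^sup>2) + \<i> * complex_of_real \<epsilon>"
  have D: "D \<noteq> 0" unfolding D_def by (rule denominator_nonzero[OF assms(2)])
  have "helmholtz h k (\<lambda>n. lgf_integrand h k \<epsilon> n \<theta>) m = 1 / D * helmholtz h k (\<lambda>n. character n \<theta>) m"
    unfolding helmholtz_cmult[symmetric] by (simp add: lgf_integrand_def D_def)
  \<comment> \<open>The eigenvalue is the denominator up to its imaginary part, so the quotient is 1
    minus a defect of order \<epsilon>.\<close>
  also have "\<dots> = 1 / D * (1 / (complex_of_real h)\<^sup>2 * (D - \<i> * complex_of_real \<epsilon>) * character m \<theta>)"
    unfolding helmholtz_character[OF assms(1)] by (simp add: D_def)
  also have "\<dots> = 1 / (complex_of_real h)\<^sup>2 * (character m \<theta> - \<i> * complex_of_real \<epsilon> * (character m \<theta> / D))"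
    using D assms(1) by (simp add: field_simps)
  finally show ?thesis by (simp add: lgf_integrand_def D_def)
qed

text \<open>The pointwise identity is integrated over the cell: orthogonality turns the character
  into the delta, and the defect remains as a multiple of \<open>lgf_reg\<close> itself.\<close>

lemma helmholtz_lgf_reg:
  fixes m :: "int ^ 'n::finite"
  assumes "h \<noteq> 0" "\<epsilon> \<noteq> 0"
  shows "helmholtz h k (lgf_reg h k \<epsilon>) m
       = 1 / (complex_of_real h)\<^sup>2 * (of_bool (m = 0) - \<i> * complex_of_real \<epsilon> * lgf_reg h k \<epsilon> m)"
proof -
  let ?c = "1 / (2 * complex_of_real pi) ^ CARD('n)"
  have "helmholtz h k (lgf_reg h k \<epsilon>) m
      = helmholtz h k (\<lambda>n. ?c * integral torus_cell (lgf_integrand h k \<epsilon> n)) m"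
    by (rule helmholtz_cong) (simp_all only: lgf_reg_eq)
  also have "\<dots> = ?c * integral torus_cell (\<lambda>\<theta>. helmholtz h k (\<lambda>n. lgf_integrand h k \<epsilon> n \<theta>) m)"
    by (simp only: helmholtz_cmult helmholtz_integral[OF integrable_lgf_integrand[OF assms(2)]])
  also have "\<dots> = ?c * (1 / (complex_of_real h)\<^sup>2 * (integral torus_cell (character m)
      - \<i> * complex_of_real \<epsilon> * integral torus_cell (lgf_integrand h k \<epsilon> m)))"
    unfolding helmholtz_lgf_integrand[OF assms] integral_mult_right
    by (subst integral_diff)
       (simp_all only: integrable_character integrable_on_mult_right integral_mult_right
         integrable_lgf_integrand[OF assms(2)])
  finally show ?thesis
    by (simp add: integral_character lgf_reg_eq field_simps)
qed

text \<open>\<open>Lim\<close> is a definite description; the existence assumption and uniqueness of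
  limits make it the actual limit.\<close>

lemma tendsto_lgf:
  fixes m :: "int ^ 'n::finite"
  assumes "lgf_exists TYPE('n) h k"
  shows "((\<lambda>\<epsilon>. lgf_reg h k \<epsilon> m) \<longlongrightarrow> lgf h k m) (at_right 0)"
proof -
  obtain l where l: "((\<lambda>\<epsilon>. lgf_reg h k \<epsilon> m) \<longlongrightarrow> l) (at_right 0)"
    using assms unfolding lgf_exists_def by blast
  then have "lgf h k m = l" unfolding lgf_def by (intro tendsto_Lim) simp_all
  with l show ?thesis by simp
qed

text \<open>The stencil is finite, so the operator commutes with the limit in \<epsilon>; the defect
  tends to 0 times a finite limit.\<close>

lemma helmholtz_lgf:
  fixes m :: "int ^ 'n::finite"
  assumes "h > 0" "lgf_exists TYPE('n) h k"
  shows "helmholtz h k (lgf h k) m = 1 / (complex_of_real h)\<^sup>2 * of_bool (m = 0)"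
proof (rule tendsto_unique[of "at_right (0::real)"])
  note lim = tendsto_lgf[OF assms(2)]
  show "((\<lambda>\<epsilon>. helmholtz h k (lgf_reg h k \<epsilon>) m) \<longlongrightarrow> helmholtz h k (lgf h k) m) (at_right 0)"
    unfolding helmholtz_def by (intro tendsto_intros lim)
  have "((\<lambda>\<epsilon>. 1 / (complex_of_real h)\<^sup>2 * (of_bool (m = 0) - \<i> * complex_of_real \<epsilon> * lgf_reg h k \<epsilon> m))
      \<longlongrightarrow> 1 / (complex_of_real h)\<^sup>2 * (of_bool (m = 0) - \<i> * complex_of_real 0 * lgf h k m)) (at_right 0)"
    by (intro tendsto_mult tendsto_diff tendsto_const tendsto_of_real tendsto_ident_at lim)
  moreover have "\<forall>\<^sub>F \<epsilon> in at_right 0. helmholtz h k (lgf_reg h k \<epsilon>) m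
      = 1 / (complex_of_real h)\<^sup>2 * (of_bool (m = 0) - \<i> * complex_of_real \<epsilon> * lgf_reg h k \<epsilon> m)"
    by (rule eventually_at_rightI[of 0 1], rule helmholtz_lgf_reg) (use assms(1) in auto)
  ultimately show "((\<lambda>\<epsilon>. helmholtz h k (lgf_reg h k \<epsilon>) m)
      \<longlongrightarrow> 1 / (complex_of_real h)\<^sup>2 * of_bool (m = 0)) (at_right 0)"
    by (simp add: tendsto_cong)
qed simp

section \<open>Outgoing solutions\<close>

text \<open>The support of a sum or difference can shrink by cancellation. Summing over a common
  finite superset makes the convolution visibly linear.\<close>

lemma outgoing_eq_sum:
  assumes "finite S" "support f \<subseteq> S"
  shows "outgoing h k f m = (complex_of_real h)\<^sup>2 * (\<Sum>n\<in>S. lgf h k (m - n) * f n)"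
proof -
  have "(\<Sum>n\<in>support f. lgf h k (m - n) * f n) = (\<Sum>n\<in>S. lgf h k (m - n) * f n)"
    by (rule sum.mono_neutral_left[OF assms]) (auto simp: support_def)
  then show ?thesis by (simp add: outgoing_def)
qed

lemma finite_support_add:
  "finite (support f) \<Longrightarrow> finite (support g) \<Longrightarrow> finite (support (\<lambda>n. f n + g n))"
  by (rule finite_subset[of _ "support f \<union> support g"]) (auto simp: support_def)

lemma outgoing_add:
  assumes "finite (support f)" "finite (support g)"
  shows "outgoing h k (\<lambda>n. f n + g n) m = outgoing h k f m + outgoing h k g m"
proof -
  let ?S = "support f \<union> support g"
  have "support (\<lambda>n. f n + g n) \<subseteq> ?S" by (auto simp: support_def)
  then show ?thesis
    using assms outgoing_eq_sum[of ?S "\<lambda>n. f n + g n"] outgoing_eq_sum[of ?S f] outgoing_eq_sum[of ?S g]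
    by (simp add: sum.distrib distrib_left)
qed

lemma outgoing_diff:
  assumes "finite (support f)" "finite (support g)"
  shows "outgoing h k (\<lambda>n. f n - g n) m = outgoing h k f m - outgoing h k g m"
proof -
  let ?S = "support f \<union> support g"
  have "support (\<lambda>n. f n - g n) \<subseteq> ?S" by (auto simp: support_def)
  then show ?thesis
    using assms outgoing_eq_sum[of ?S "\<lambda>n. f n - g n"] outgoing_eq_sum[of ?S f] outgoing_eq_sum[of ?S g]
    by (simp add: sum_subtractf right_diff_distrib)
qed

text \<open>The field is a finite superposition of translates of the Green's function, and the
  factor \<open>h\<close> squared cancels that of the delta.\<close>

lemma helmholtz_outgoing:
  fixes f :: "int ^ 'n::finite \<Rightarrow> complex"
  assumes "h > 0" "lgf_exists TYPE('n) h k" "finite (support f)"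
  shows "helmholtz h k (outgoing h k f) m = f m"
proof -
  have "helmholtz h k (outgoing h k f) m
      = helmholtz h k (\<lambda>m. (complex_of_real h)\<^sup>2 * (\<Sum>n\<in>support f. f n * lgf h k (m + - n))) m"
    by (rule helmholtz_cong) (simp_all add: outgoing_def mult.commute)
  also have "\<dots> = (complex_of_real h)\<^sup>2 * (\<Sum>n\<in>support f. f n * helmholtz h k (lgf h k) (m + - n))"
    by (simp only: helmholtz_cmult helmholtz_sum helmholtz_shift)
  also have "\<dots> = (\<Sum>n\<in>support f. if n = m then f n else 0)"
    unfolding helmholtz_lgf[OF assms(1,2)] sum_distrib_left
    using assms(1) by (intro sum.cong) auto
  \<comment> \<open>Off the support the sum is 0, which is again the value of
    \<open>f\<close>.\<close>
  also have "\<dots> = f m" using assms(3) by (simp add: support_def)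
  finally show ?thesis .
qed

text \<open>Convolution also inverts the operator from the left on finitely supported functions:
  summation by parts moves the operator onto the Green's function, where it yields a delta.\<close>

lemma outgoing_helmholtz:
  fixes V :: "int ^ 'n::finite \<Rightarrow> complex"
  assumes "h > 0" "lgf_exists TYPE('n) h k" "finite (support V)"
  shows "outgoing h k (helmholtz h k V) m = V m"
proof -
  have "outgoing h k (helmholtz h k V) m
      = (complex_of_real h)\<^sup>2 * (\<Sum>n\<in>support V. helmholtz h k (lgf h k) (m - n) * V n)"
    using sum_helmholtz_symmetric[OF assms(3), where h = h and k = k and w = "\<lambda>n. lgf h k (m - n)"]
    by (simp add: outgoing_def helmholtz_reflect)
  also have "\<dots> = (\<Sum>n\<in>support V. if n = m then V n else 0)"
    unfolding helmholtz_lgf[OF assms(1,2)] sum_distrib_left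
    using assms(1) by (intro sum.cong) auto
  also have "\<dots> = V m" using assms(3) by (simp add: support_def)
  finally show ?thesis .
qed

section \<open>The auxiliary source\<close>

lemma finite_stencil_nodes:
  assumes "finite M"
  shows "finite (stencil_nodes M)"
proof -
  have "{m + e | m e. m \<in> M \<and> e \<in> unit_steps} = (\<lambda>(m, e). m + e) ` (M \<times> unit_steps)"
    by force
  moreover have "finite ((\<lambda>(m, e). m + e) ` (M \<times> unit_steps))"
    by (intro finite_imageI finite_cartesian_product assms finite_unit_steps)
  ultimately show ?thesis using assms by (simp add: stencil_nodes_def)
qed

text \<open>A norm bound \<open>B\<close> on the domain confines each integer coordinate to absolute
  value at most \<open>B / h\<close>.\<close>

lemma finite_M_plus:
  fixes \<Omega> :: "(real ^ 'n::finite) set"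
  assumes "h > 0" "bounded \<Omega>"
  shows "finite (M_plus h \<Omega>)"
proof -
  obtain B where B: "\<And>x. x \<in> \<Omega> \<Longrightarrow> norm x \<le> B"
    using assms(2) by (auto simp: bounded_iff)
  let ?K = "\<lceil>B / h\<rceil>"
  have "M_plus h \<Omega> \<subseteq> vec_lambda ` (UNIV \<rightarrow>\<^sub>E {- ?K..?K} :: ('n \<Rightarrow> int) set)"
  proof
    fix m assume "m \<in> M_plus h \<Omega>"
    then have "norm (node h m) \<le> B" using B by (simp add: M_plus_def)
    then have "\<bar>node h m $ j\<bar> \<le> B" for j
      using component_le_norm_cart[of "node h m" j] by linarith
    then have "\<bar>real_of_int (m $ j)\<bar> \<le> B / h" for j
      using assms(1) by (simp add: node_def abs_mult field_simps)
    then have "\<bar>m $ j\<bar> \<le> ?K" for j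
      by (metis le_of_int_ceiling of_int_abs of_int_le_iff order_trans)
    then have "vec_nth m \<in> UNIV \<rightarrow>\<^sub>E {- ?K..?K}" by (auto simp: abs_le_iff minus_le_iff)
    then show "m \<in> vec_lambda ` (UNIV \<rightarrow>\<^sub>E {- ?K..?K})"
      by (metis image_eqI vec_nth_inverse)
  qed
  then show ?thesis by (rule finite_subset) (intro finite_imageI finite_PiE, auto)
qed

text \<open>An open set is its own interior, so its closure adds only frontier points, which no node
  meets.\<close>

lemma M_minus_eq_Compl_M_plus:
  assumes "open \<Omega>" "\<forall>m. node h m \<notin> frontier \<Omega>"
  shows "M_minus h \<Omega> = - M_plus h \<Omega>"
  using assms closure_subset[of \<Omega>]
  by (auto simp: M_minus_def M_plus_def frontier_def interior_open)

lemma finite_support_aux_source: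
  assumes "finite (support V)"
  shows "finite (support (aux_source h k \<Omega> V))"
  by (rule finite_subset[OF _ finite_support_helmholtz[OF assms, of h k]])
     (auto simp: support_def aux_source_def)

text \<open>The right-hand side does not mention \<open>V\<close>, which is why the extension is
  immaterial. The field \<open>u\<close> enters only through its equation on \<open>M_plus\<close>
  and may have infinite support.\<close>

lemma outgoing_aux_source:
  fixes u f V :: "int ^ 'n::finite \<Rightarrow> complex"
  assumes h: "h > 0" and lgf: "lgf_exists TYPE('n) h k"
    and \<Omega>: "open \<Omega>" "bounded \<Omega>" "\<forall>m. node h m \<notin> frontier \<Omega>"
    and f: "finite (support f)" "support f \<subseteq> M_plus h \<Omega>"
    and u: "\<And>n. n \<in> M_plus h \<Omega> \<Longrightarrow> helmholtz h k u n = f n"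
    and V: "trace_extension h \<Omega> u V"
    and m: "m \<in> N_plus h \<Omega>"
  shows "outgoing h k (aux_source h k \<Omega> V) m = outgoing h k f m - u m"
proof -
  define W where "W = (\<lambda>n. if n \<in> N_plus h \<Omega> then u n else V n)"
  have V_fin: "finite (support V)" and V_eq: "\<And>n. n \<in> boundary_strip h \<Omega> \<Longrightarrow> V n = u n"
    using V by (auto simp: trace_extension_def)
  have W_plus: "W n = u n" if "n \<in> N_plus h \<Omega>" for n
    using that by (simp add: W_def)
  \<comment> \<open>A node of \<open>N_minus\<close> either lies outside \<open>N_plus\<close> or
    belongs to the strip, where \<open>V\<close> carries the trace of \<open>u\<close>.\<close>
  have W_minus: "W n = V n" if "n \<in> N_minus h \<Omega>" for n
    using that V_eq by (auto simp: W_def boundary_strip_def)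
  have "finite (N_plus h \<Omega>)"
    unfolding N_plus_def by (intro finite_stencil_nodes finite_M_plus h \<Omega>(2))
  moreover have "support W \<subseteq> N_plus h \<Omega> \<union> support V"
    by (auto simp: W_def support_def)
  ultimately have W_fin: "finite (support W)"
    using V_fin by (meson finite_UnI finite_subset)
  \<comment> \<open>Each stencil lies wholly in \<open>N_plus\<close> or wholly in
    \<open>N_minus\<close>, according to its centre, so gluing creates no mixed stencils. On either
    side one of the two sources vanishes.\<close>
  have "helmholtz h k W n = f n - aux_source h k \<Omega> V n" for n
  proof (cases "n \<in> M_plus h \<Omega>")
    case True
    then have "helmholtz h k W n = helmholtz h k u n"
      by (intro helmholtz_cong W_plus) (auto simp: N_plus_def stencil_nodes_def)
    then show ?thesis
      using True u M_minus_eq_Compl_M_plus[OF \<Omega>(1,3)] by (simp add: aux_source_def)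
  next
    case False
    then have n: "n \<in> M_minus h \<Omega>" using M_minus_eq_Compl_M_plus[OF \<Omega>(1,3)] by simp
    then have "helmholtz h k W n = helmholtz h k V n"
      by (intro helmholtz_cong W_minus) (auto simp: N_minus_def stencil_nodes_def)
    moreover have "f n = 0" using f(2) False by (auto simp: support_def)
    ultimately show ?thesis using n by (simp add: aux_source_def)
  qed
  then have "helmholtz h k W = (\<lambda>n. f n - aux_source h k \<Omega> V n)" by blast
  then have "W m = outgoing h k f m - outgoing h k (aux_source h k \<Omega> V) m"
    using outgoing_helmholtz[OF h lgf W_fin, of m]
      outgoing_diff[OF f(1) finite_support_aux_source[OF V_fin, of h k \<Omega>]]
    by simp
  then show ?thesis using W_plus[OF m] by simp
qed

theorem theorem4p5:
  fixes h k :: real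
    and \<Omega> :: "(real ^ 'n::finite) set"
    and fp fm up um u :: "int ^ 'n \<Rightarrow> complex"
  assumes dim: "CARD('n) \<in> {2, 3}"
    and h_pos: "h > 0" and k_pos: "k > 0"
    and domain: "bounded_lipschitz_domain \<Omega>"
    and no_node_on_boundary: "\<forall>m. node h m \<notin> frontier \<Omega>"
    and lgf: "lgf_exists TYPE('n) h k"
    and nonres: "nonresonant h k \<Omega>"
    and fp: "finite (support fp)" "support fp \<subseteq> M_plus h \<Omega>"
    and fm: "finite (support fm)" "support fm \<subseteq> M_minus h \<Omega>"
    and up: "up = outgoing h k fp"
    and um: "um = outgoing h k fm"
    and u: "u = (\<lambda>m. up m + um m)"
  shows "(\<forall>V g ut. trace_extension h \<Omega> u V
            \<and> g = aux_source h k \<Omega> V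
            \<and> ut = outgoing h k (\<lambda>m. fp m + fm m + g m)
            \<longrightarrow> (\<forall>m. helmholtz h k ut m = fp m + fm m + g m)
                \<and> (\<forall>m\<in>N_plus h \<Omega>. ut m = up m))
       \<and> (\<forall>V1 V2 g1 g2. trace_extension h \<Omega> u V1 \<and> trace_extension h \<Omega> u V2
            \<and> g1 = aux_source h k \<Omega> V1 \<and> g2 = aux_source h k \<Omega> V2
            \<longrightarrow> (\<forall>m\<in>N_plus h \<Omega>. outgoing h k (\<lambda>n. g1 n - g2 n) m = 0))"
proof -
  have \<Omega>: "open \<Omega>" "bounded \<Omega>" using domain by (auto simp: bounded_lipschitz_domain_def)
  have u_eq: "helmholtz h k u n = fp n" if "n \<in> M_plus h \<Omega>" for n
  proof -
    have "fm n = 0"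
      using that fm(2) M_minus_eq_Compl_M_plus[OF \<Omega>(1) no_node_on_boundary]
      by (auto simp: support_def)
    then show ?thesis
      unfolding u up um
      by (simp add: helmholtz_add helmholtz_outgoing[OF h_pos lgf] fp(1) fm(1))
  qed
  \<comment> \<open>The auxiliary source cancels exactly the field of the exterior source, since
    \<open>up - u = - um\<close>.\<close>
  have aux: "outgoing h k (aux_source h k \<Omega> V) m = - um m"
    if "trace_extension h \<Omega> u V" "m \<in> N_plus h \<Omega>" for V m
    using outgoing_aux_source[OF h_pos lgf \<Omega> no_node_on_boundary fp u_eq that] by (simp add: up u)
  have fin: "finite (support (aux_source h k \<Omega> V))" if "trace_extension h \<Omega> u V" for V
    using that by (intro finite_support_aux_source) (simp add: trace_extension_def)
  \<comment> \<open>By linearity \<open>ut\<close> is \<open>up + um - um\<close> on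
    \<open>N_plus\<close>, and two auxiliary sources have the same convolution \<open>- um\<close>
    there.\<close>
  show ?thesis
    using aux fin fp(1) fm(1)
    by (auto simp: helmholtz_outgoing[OF h_pos lgf] finite_support_add outgoing_add outgoing_diff
        up um)
qed

end
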